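(* Let $h>0$ and let $-\Delta_h$ be the five-point discrete Poisson operator on $G_h$ with stencil $$-\Delta_h=\frac{1}{h^2}\begin{bmatrix} & -1 & \\ -1 & 4 & -1\\ & -1 & \end{bmatrix}_h .$$ For the two-color Jacobi point relaxation applied to $-\Delta_h$, the optimal one-stage relaxation parameter and the related smoothing factor are $$\omega_{opt}=\frac{16}{17},\qquad \rho_{opt}=\frac{1}{17}.$$
   Context: Let $G_h=\{(k_1h,k_2h)\mid (k_1,k_2)\in\mathbb{Z}^2\}$ with mesh size $h>0$. A scalar discrete operator $D_h=[l_{\vec{k}}]_h$ with stencil coefficients $l_{\vec{k}}\in\mathbb{R}$, $\vec{k}\in J\subset\mathbb{Z}^2$ ($J$ finite, containing $(0,0)$), has Fourier symbol $\tilde{D}_h(\vec{\theta})=\sum_{\vec{k}\in J}l_{\vec{k}}\exp(i\vec{\theta}\cdot\vec{k})$ for $\vec{\theta}\in(-\pi,\pi]^2$. In particular $-\tilde{\Delta}_h(\vec{\theta})=\frac{1}{h^2}(4-2\cos\theta_1-2\cos\theta_2)$. Let $\tilde{D}_h^0(\vec{\theta})=l_{(0,0)}$ be the symbol of the diagonal part of $D_h$. Let $\Theta_{low}=(-\frac{\pi}{2},\frac{\pi}{2}]^2$. For $\vec{\theta}\in\Theta_{low}$ and $\alpha\in\{0,1\}$ put $\vec{\theta}^\alpha=(\vec{\theta}+(\alpha,\alpha)\pi)\bmod 2\pi$ (components in $(-\pi,\pi]$) and $A_\alpha=1-\tilde{D}_h(\vec{\theta}^\alpha)/\tilde{D}_h^0(\vec{\theta}^\alpha)$,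 the symbol of Jacobi point relaxation. The Fourier representation of the two-color Jacobi point relaxation for $D_h$ with relaxation parameter $\omega=1$, on the span of the modes with frequencies $\vec{\theta}^0,\vec{\theta}^1$, is $$\widehat{S}_h^{01}(\vec{\theta},1)=\frac12\begin{pmatrix}A_0+1 & -A_1+1\\ -A_0+1 & A_1+1\end{pmatrix}\cdot\frac12\begin{pmatrix}A_0+1 & A_1-1\\ A_0-1 & A_1+1\end{pmatrix}.$$ The ideal coarse-grid correction has the representation $\widehat{Q}_h^{2h}=\mathrm{diag}(0,1)$. Let $S_{\max}$ and $S_{\min}$ (which lie in $(-1,1)$) be the maximum and minimum, over all $\vec{\theta}\in\Theta_{low}$, of the eigenvalues of $\widehat{Q}_h^{2h}\widehat{S}_h^{01}(\vec{\theta},1)$. The optimal one-stage relaxation parameter and the related smoothing factor are defined by $$\omega_{opt}=\frac{2}{2-S_{\max}-S_{\min}},\qquad \rho_{opt}=\frac{S_{\max}-S_{\min}}{2-S_{\max}-S_{\min}}.$$ *)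

theory Defs
  imports
    "HOL-Library.Real_Mod"
    "Jordan_Normal_Form.Spectral_Radius"
begin

text \<open>
  A scalar stencil \<open>[l_k]_h\<close>: the index set \<open>J\<close> and the coefficients \<open>l_k\<close>, of which only those
  with \<open>k \<in> J\<close> matter. \<open>J\<close> is meant to be finite and to contain \<open>(0, 0)\<close>. The mesh size enters
  only through the coefficients, since the frequencies are scaled by \<open>h\<close>.
\<close>
record stencil =
  offsets :: "(int \<times> int) set"
  stencil_coeff :: "int \<times> int \<Rightarrow> real"

definition neg_laplace :: "real \<Rightarrow> stencil" where
  "neg_laplace h =
     \<lparr> offsets = {(0, 0), (1, 0), (-1, 0), (0, 1), (0, -1)},
       stencil_coeff = (\<lambda>k. 1 / h\<^sup>2 * (if k = (0, 0) then 4 else -1)) \<rparr>"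

definition fourier_symbol :: "stencil \<Rightarrow> real \<times> real \<Rightarrow> complex" where
  "fourier_symbol D \<theta> =
     (\<Sum>k\<in>offsets D. complex_of_real (stencil_coeff D k) *
        exp (\<i> * complex_of_real (fst \<theta> * of_int (fst k) + snd \<theta> * of_int (snd k))))"

definition diag_symbol :: "stencil \<Rightarrow> real \<times> real \<Rightarrow> complex" where
  "diag_symbol D \<theta> = complex_of_real (stencil_coeff D (0, 0))"

definition Theta_low :: "(real \<times> real) set" where
  "Theta_low = {- pi / 2 <.. pi / 2} \<times> {- pi / 2 <.. pi / 2}"

text \<open>
  The representative modulo \<open>2 \<pi>\<close> in the half-open interval from \<open>- \<pi>\<close> (excluded) to \<open>\<pi>\<close>
  (included). The reflection is needed because \<open>x rmod y\<close> lies in \<open>[0, y)\<close>.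
\<close>
definition wrap_angle :: "real \<Rightarrow> real" where
  "wrap_angle t = pi - (pi - t) rmod (2 * pi)"

definition shifted_freq :: "real \<times> real \<Rightarrow> nat \<Rightarrow> real \<times> real" where
  "shifted_freq \<theta> \<alpha> = (wrap_angle (fst \<theta> + of_nat \<alpha> * pi), wrap_angle (snd \<theta> + of_nat \<alpha> * pi))"

definition jacobi_symbol :: "stencil \<Rightarrow> real \<times> real \<Rightarrow> nat \<Rightarrow> complex" where
  "jacobi_symbol D \<theta> \<alpha> =
     1 - fourier_symbol D (shifted_freq \<theta> \<alpha>) / diag_symbol D (shifted_freq \<theta> \<alpha>)"

definition two_color_jacobi :: "stencil \<Rightarrow> real \<times> real \<Rightarrow> complex mat" where
  "two_color_jacobi D \<theta> =
     (let A0 = jacobi_symbol D \<theta> 0; A1 = jacobi_symbol D \<theta> 1 in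
       ((1 / 2) \<cdot>\<^sub>m mat_of_rows_list 2 [[A0 + 1, - A1 + 1], [- A0 + 1, A1 + 1]]) *
       ((1 / 2) \<cdot>\<^sub>m mat_of_rows_list 2 [[A0 + 1, A1 - 1], [A0 - 1, A1 + 1]]))"

definition ideal_cgc :: "complex mat" where
  "ideal_cgc = mat_of_rows_list 2 [[0, 0], [0, 1]]"

definition smoothing_eigenvalues :: "stencil \<Rightarrow> complex set" where
  "smoothing_eigenvalues D = (\<Union>\<theta>\<in>Theta_low. spectrum (ideal_cgc * two_color_jacobi D \<theta>))"

text \<open>
  Maximum and minimum presuppose that all the eigenvalues are real and that the extremum is attained;
  otherwise the values below are unspecified.
\<close>
definition S_max :: "stencil \<Rightarrow> real" where
  "S_max D = (THE s. complex_of_real s \<in> smoothing_eigenvalues D \<and>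
                     (\<forall>\<mu>\<in>smoothing_eigenvalues D. \<mu> \<in> \<real> \<and> Re \<mu> \<le> s))"

definition S_min :: "stencil \<Rightarrow> real" where
  "S_min D = (THE s. complex_of_real s \<in> smoothing_eigenvalues D \<and>
                     (\<forall>\<mu>\<in>smoothing_eigenvalues D. \<mu> \<in> \<real> \<and> s \<le> Re \<mu>))"

definition omega_opt :: "stencil \<Rightarrow> real" where
  "omega_opt D = 2 / (2 - S_max D - S_min D)"

definition rho_opt :: "stencil \<Rightarrow> real" where
  "rho_opt D = (S_max D - S_min D) / (2 - S_max D - S_min D)"

end

theory Submission
  imports Defs
begin

text \<open>
  Everything depends on the single quantity \<open>c = (cos \<theta>\<^sub>1 + cos \<theta>\<^sub>2) / 2\<close>. For the five-point
  operator the Jacobi symbol at the low frequency is \<open>A\<^sub>0 = c\<close>; shifting both angles by \<open>\<pi>\<close> flips the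
  sign of both cosines, so \<open>A\<^sub>1 = - c\<close>, and the mesh size cancels against the diagonal.

  The ideal coarse-grid correction deletes the first row of the two-colour matrix. What is left is
  lower triangular with diagonal \<open>(0, m)\<close>, so its eigenvalues are \<open>0\<close> and the lower right entry
  \<open>m = c (c - 1) / 2\<close>. On the low frequencies both cosines lie in \<open>[0, 1]\<close>, hence so does \<open>c\<close>, and
  the parabola \<open>c (c - 1) / 2\<close> lies between \<open>- 1 / 8\<close>, its vertex value, and \<open>0\<close>. The vertex
  \<open>c = 1 / 2\<close> is reached at \<open>\<theta> = (\<pi> / 3, \<pi> / 3)\<close>, while \<open>0\<close> is an eigenvalue at every frequency.
  Thus \<open>S\<^sub>m\<^sub>a\<^sub>x = 0\<close> and \<open>S\<^sub>m\<^sub>i\<^sub>n = - 1 / 8\<close>, and substituting these values gives the result.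
\<close>

lemma cos_wrap_angle [simp]: "cos (wrap_angle t) = cos t"
proof -
  obtain k :: int where "wrap_angle t = t + 2 * pi * of_int k"
    by (force simp: wrap_angle_def rmod_def algebra_simps)
  then show ?thesis
    by (metis cos_int_times_real cos_add sin_int_2pin cos_int_2pin mult_1_right mult_zero_right diff_zero)
qed

text \<open>Opposite neighbours have equal coefficients, so their exponentials combine to real cosines.\<close>
lemma fourier_symbol_neg_laplace:
  "fourier_symbol (neg_laplace h) \<theta> =
     complex_of_real (1 / h\<^sup>2 * (4 - 2 * cos (fst \<theta>) - 2 * cos (snd \<theta>)))"
  by (simp add: fourier_symbol_def neg_laplace_def exp_eq_polar cis_conv_exp[symmetric] complex_eq_iff
      algebra_simps)

definition mean_cos :: "real \<times> real \<Rightarrow> real" where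
  "mean_cos \<theta> = (cos (fst \<theta>) + cos (snd \<theta>)) / 2"

text \<open>
  Dividing by the diagonal \<open>4 / h\<^sup>2\<close> removes the mesh size, and a shift by \<open>\<pi>\<close> negates each cosine;
  reduction modulo \<open>2 \<pi>\<close> does not affect cosines.
\<close>
lemma jacobi_symbol_neg_laplace:
  assumes "h \<noteq> 0"
  shows "jacobi_symbol (neg_laplace h) \<theta> 0 = complex_of_real (mean_cos \<theta>)"
    and "jacobi_symbol (neg_laplace h) \<theta> 1 = - complex_of_real (mean_cos \<theta>)"
proof -
  have "jacobi_symbol (neg_laplace h) \<theta> \<alpha> = complex_of_real (mean_cos (shifted_freq \<theta> \<alpha>))" for \<alpha>
    unfolding jacobi_symbol_def fourier_symbol_neg_laplace
    using assms by (simp add: diag_symbol_def neg_laplace_def mean_cos_def field_simps)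
  then show "jacobi_symbol (neg_laplace h) \<theta> 0 = complex_of_real (mean_cos \<theta>)"
    and "jacobi_symbol (neg_laplace h) \<theta> 1 = - complex_of_real (mean_cos \<theta>)"
    by (simp_all add: mean_cos_def shifted_freq_def field_simps)
qed

lemma spectrum_lower_triangular_2:
  fixes a b d :: complex
  shows "spectrum (mat_of_rows_list 2 [[a, 0], [b, d]]) = {a, d}"
proof -
  let ?M = "mat_of_rows_list 2 [[a, 0], [b, d]]"
  have M: "?M \<in> carrier_mat 2 2"
    by (auto simp: mat_of_rows_list_def)
  have "det (char_matrix ?M k) = (a - k) * (d - k)" for k
    by (subst det_lower_triangular[of 2])
       (auto simp: char_matrix_def mat_of_rows_list_def diag_mat_def less_Suc_eq numeral_2_eq_2)
  then show ?thesis
    by (auto simp: spectrum_def eigenvalue_det[OF M])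
qed

text \<open>
  Multiplying by \<open>diag (0, 1)\<close> from the left clears the first row, which makes the product lower
  triangular: its eigenvalues can be read off the diagonal.
\<close>
lemma ideal_cgc_mult_two_color_jacobi:
  fixes D \<theta>
  defines "A0 \<equiv> jacobi_symbol D \<theta> 0" and "A1 \<equiv> jacobi_symbol D \<theta> 1"
  shows "ideal_cgc * two_color_jacobi D \<theta> =
    mat_of_rows_list 2 [[0, 0], [((1 - A0) * (A0 + 1) + (A1 + 1) * (A0 - 1)) / 4,
                                 ((1 - A0) * (A1 - 1) + (A1 + 1) * (A1 + 1)) / 4]]"
  unfolding two_color_jacobi_def Let_def ideal_cgc_def A0_def[symmetric] A1_def[symmetric]
  by (rule eq_matI)
     (auto simp: mat_of_rows_list_def scalar_prod_def less_Suc_eq numeral_2_eq_2 field_simps)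

text \<open>
  With \<open>A\<^sub>0 = c\<close> and \<open>A\<^sub>1 = - c\<close> both terms of the lower right entry contain the factor \<open>1 - c\<close>, which
  leaves \<open>(1 - c) (- 2 c) / 4\<close>.
\<close>
lemma smoothing_eigenvalues_neg_laplace:
  assumes "h \<noteq> 0"
  shows "smoothing_eigenvalues (neg_laplace h) =
    (\<Union>\<theta>\<in>Theta_low. {0, complex_of_real (mean_cos \<theta> * (mean_cos \<theta> - 1) / 2)})"
proof -
  have m: "((1 - c) * (- c - 1) + (- c + 1) * (- c + 1)) / 4 = c * (c - 1) / 2" for c :: complex
    by (simp add: field_simps)
  show ?thesis
    unfolding smoothing_eigenvalues_def ideal_cgc_mult_two_color_jacobi
      jacobi_symbol_neg_laplace[OF assms] spectrum_lower_triangular_2 m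
    by simp
qed

lemma mean_cos_Theta_low:
  assumes "\<theta> \<in> Theta_low"
  shows "0 \<le> mean_cos \<theta>" and "mean_cos \<theta> \<le> 1"
proof -
  have "0 \<le> cos (fst \<theta>)" "0 \<le> cos (snd \<theta>)"
    using assms by (auto simp: Theta_low_def intro!: cos_ge_zero)
  moreover have "cos (fst \<theta>) \<le> 1" "cos (snd \<theta>) \<le> 1"
    by simp_all
  ultimately show "0 \<le> mean_cos \<theta>" and "mean_cos \<theta> \<le> 1"
    using add_mono[of "cos (fst \<theta>)" 1 "cos (snd \<theta>)" 1] by (simp_all add: mean_cos_def)
qed

text \<open>
  \<^const>\<open>S_max\<close> and \<^const>\<open>S_min\<close> are definite descriptions, so exhibiting an attained bound has to
  include its uniqueness; the two rules below settle that once by antisymmetry.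
\<close>
lemma S_max_eqI:
  assumes "complex_of_real s \<in> smoothing_eigenvalues D"
    and "\<And>\<mu>. \<mu> \<in> smoothing_eigenvalues D \<Longrightarrow> \<mu> \<in> \<real> \<and> Re \<mu> \<le> s"
  shows "S_max D = s"
  unfolding S_max_def using assms by (intro the_equality) (auto intro!: antisym, fastforce+)

lemma S_min_eqI:
  assumes "complex_of_real s \<in> smoothing_eigenvalues D"
    and "\<And>\<mu>. \<mu> \<in> smoothing_eigenvalues D \<Longrightarrow> \<mu> \<in> \<real> \<and> s \<le> Re \<mu>"
  shows "S_min D = s"
  unfolding S_min_def using assms by (intro the_equality) (auto intro!: antisym, fastforce+)

lemma S_max_neg_laplace:
  assumes "h \<noteq> 0"
  shows "S_max (neg_laplace h) = 0"
proof (rule S_max_eqI)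
  have "(0, 0) \<in> Theta_low"
    by (simp add: Theta_low_def)
  then show "complex_of_real 0 \<in> smoothing_eigenvalues (neg_laplace h)"
    unfolding smoothing_eigenvalues_neg_laplace[OF assms] by auto
next
  fix \<mu> assume "\<mu> \<in> smoothing_eigenvalues (neg_laplace h)"
  then obtain \<theta> where \<theta>: "\<theta> \<in> Theta_low"
    and \<mu>: "\<mu> = 0 \<or> \<mu> = complex_of_real (mean_cos \<theta> * (mean_cos \<theta> - 1) / 2)"
    unfolding smoothing_eigenvalues_neg_laplace[OF assms] by blast
  have "mean_cos \<theta> * (mean_cos \<theta> - 1) \<le> 0"
    using mean_cos_Theta_low[OF \<theta>] by (simp add: mult_nonneg_nonpos)
  then show "\<mu> \<in> \<real> \<and> Re \<mu> \<le> 0"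
    using \<mu> by (auto simp del: of_real_mult of_real_diff of_real_divide)
qed

lemma S_min_neg_laplace:
  assumes "h \<noteq> 0"
  shows "S_min (neg_laplace h) = - 1 / 8"
proof (rule S_min_eqI)
  \<comment> \<open>Both cosines equal \<open>1 / 2\<close> here, so the mean cosine sits at the vertex of the parabola.\<close>
  have "(pi / 3, pi / 3) \<in> Theta_low"
    by (simp add: Theta_low_def field_simps)
  moreover have "mean_cos (pi / 3, pi / 3) = 1 / 2"
    by (simp add: mean_cos_def cos_60)
  ultimately show "complex_of_real (- 1 / 8) \<in> smoothing_eigenvalues (neg_laplace h)"
    unfolding smoothing_eigenvalues_neg_laplace[OF assms]
    by (intro UN_I[of "(pi / 3, pi / 3)"]) (simp_all only:, simp)
next
  fix \<mu> assume "\<mu> \<in> smoothing_eigenvalues (neg_laplace h)"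
  then obtain \<theta> where
    \<mu>: "\<mu> = 0 \<or> \<mu> = complex_of_real (mean_cos \<theta> * (mean_cos \<theta> - 1) / 2)"
    unfolding smoothing_eigenvalues_neg_laplace[OF assms] by blast
  \<comment> \<open>\<open>c (c - 1) / 2 + 1 / 8\<close> is half of this square.\<close>
  have "0 \<le> (mean_cos \<theta> - 1 / 2)\<^sup>2"
    by simp
  then have "- 1 / 8 \<le> mean_cos \<theta> * (mean_cos \<theta> - 1) / 2"
    by (simp add: power2_eq_square field_simps)
  then show "\<mu> \<in> \<real> \<and> - 1 / 8 \<le> Re \<mu>"
    using \<mu> by (auto simp del: of_real_mult of_real_diff of_real_divide)
qed

theorem theorem3:
  fixes h :: real
  assumes "h > 0"
  shows "omega_opt (neg_laplace h) = 16 / 17 \<and> rho_opt (neg_laplace h) = 1 / 17"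
proof -
  have "h \<noteq> 0"
    using assms by simp
  then show ?thesis
    by (simp add: omega_opt_def rho_opt_def S_max_neg_laplace S_min_neg_laplace)
qed

end
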